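(* Let $N\ge 1$, and for $i=1,\dots,N$ let $\mathcal{X}_{a,i}\subseteq\mathbb{R}^{n_{a,i}}$, $\mathcal{X}_{b,i}\subseteq\mathbb{R}^{n_{b,i}}$, and let $\mathcal{X}_a\subseteq\mathbb{R}^{n_a}$, $\mathcal{X}_b\subseteq\mathbb{R}^{n_b}$ be compact convex sets, where $n_a=\sum_i n_{a,i}$ and $n_b=\sum_i n_{b,i}$. For each $i$ let $f_i:\mathcal{X}_{a,i}\times\mathcal{X}_{b,i}\to\mathbb{R}$ be convex and lower semicontinuous in its first argument and concave and upper semicontinuous in its second argument. Let $\mathcal{L}$ be the Lagrangian defined in the context, and assume that there exists a point $(x_a^*,x_b^*,z_a^*,z_b^*,\lambda_a^*,\lambda_b^* )$ at which $\mathcal{L}$ is finite and such that, for all $x_a,z_a,\lambda_a\in\mathbb{R}^{n_a}$ and all $x_b,z_b,\lambda_b\in\mathbb{R}^{n_b}$, $$\mathcal{L}(x_a^*,x_b^*,z_a^*,z_b^*,\lambda_a,\lambda_b^* )\le \mathcal{L}(x_a^*,x_b^*,z_a^*,z_b^*,\lambda_a^*,\lambda_b^* )\le \mathcal{L}(x_a,x_b^*,z_a,z_b^*,\lambda_a^*,\lambda_b^* )$$ and $$\mathcal{L}(x_a^*,x_b,z_a^*,z_b,\lambda_a^*,\lambda_b^* )\le \mathcal{L}(x_a^*,x_b^*,z_a^*,z_b^*,\lambda_a^*,\lambda_b^* )\le \mathcal{L}(x_a^*,x_b^*,z_a^*,z_b^*,\lambda_a^*,\lambda_b).$$ Let $\rho_a>0$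 and $\rho_b>0$, and let $(x_a^k,x_b^k,z_a^k,z_b^k,\lambda_a^k,\lambda_b^k)_{k\ge 0}$ be the iterates generated by SP-ADMM (defined in the context) with penalty parameters $\rho_a,\rho_b$ from any admissible initialization. Then there is a saddle point $(\bar x_a,\bar x_b)$ of the problem $$\min_{x_a}\max_{x_b}\ \sum_{i=1}^N f_i(x_{a,i},x_{b,i})\quad\text{subject to}\quad x_a\in\mathcal{X}_a,\ x_b\in\mathcal{X}_b,\ x_{a,i}\in\mathcal{X}_{a,i},\ x_{b,i}\in\mathcal{X}_{b,i}\ (i=1,\dots,N)$$ such that $z_a^k\to\bar x_a$ and $z_b^k\to\bar x_b$ as $k\to\infty$.
   Context: Vectors $x_a\in\mathbb{R}^{n_a}$ and $x_b\in\mathbb{R}^{n_b}$ are written in blocks $x_a=[x_{a,1},\dots,x_{a,N}]$, $x_b=[x_{b,1},\dots,x_{b,N}]$ with $x_{a,i}\in\mathbb{R}^{n_{a,i}}$, $x_{b,i}\in\mathbb{R}^{n_{b,i}}$. For a set $\mathcal{X}$, $I_{\mathcal{X}}(x)=0$ if $x\in\mathcal{X}$ and $I_{\mathcal{X}}(x)=+\infty$ otherwise. Lagrangian: $$\mathcal{L}(x_a,x_b,z_a,z_b,\lambda_a,\lambda_b)=\sum_{i=1}^N\big(f_i(x_{a,i},x_{b,i})+I_{\mathcal{X}_{a,i}}(x_{a,i})-I_{\mathcal{X}_{b,i}}(x_{b,i})\big)+\lambda_a^\top(x_a-z_a)+I_{\mathcal{X}_a}(z_a)-\lambda_b^\top(x_b-z_b)-I_{\mathcal{X}_b}(z_b).$$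 Convention: $\mathcal{L}$ takes the value $+\infty$ if the minimizer's variables violate $x_{a,i}\in\mathcal{X}_{a,i}$ for some $i$ or $z_a\in\mathcal{X}_a$ while the maximizer's variables satisfy $x_{b,i}\in\mathcal{X}_{b,i}$ for all $i$ and $z_b\in\mathcal{X}_b$; it takes the value $-\infty$ in the reverse situation. Finiteness of $\mathcal{L}$ at the starred point means exactly that $x_{a,i}^*\in\mathcal{X}_{a,i}$ and $x_{b,i}^*\in\mathcal{X}_{b,i}$ for all $i$, $z_a^*\in\mathcal{X}_a$ and $z_b^*\in\mathcal{X}_b$; then every evaluation of $\mathcal{L}$ in the inequalities is well defined in $[-\infty,+\infty]$. Augmented Lagrangian: $$\hat{\mathcal{L}}(x_a,x_b,z_a,z_b,\lambda_a,\lambda_b)=\mathcal{L}(x_a,x_b,z_a,z_b,\lambda_a,\lambda_b)+\frac{\rho_a}{2}\|x_a-z_a\|_2^2-\frac{\rho_b}{2}\|x_b-z_b\|_2^2.$$ SP-ADMM (saddle-point alternating direction method of multipliers): Initialize with $x_a^0\in\mathcal{X}_{a,1}\times\cdots\times\mathcal{X}_{a,N}$, $x_b^0\in\mathcal{X}_{b,1}\times\cdots\times\mathcal{X}_{b,N}$, $z_a^0\in\mathcal{X}_a$, $z_b^0\in\mathcal{X}_b$, and any $\lambda_a^0\in\mathbb{R}^{n_a}$, $\lambda_b^0\in\mathbb{R}^{n_b}$. For $k=0,1,2,\dots$: (i) $(x_a^{k+1},x_b^{k+1})=\arg\min_{x_a}\max_{x_b}\hat{\mathcal{L}}(x_a,x_b,z_a^k,z_b^k,\lambda_a^k,\lambda_b^k)$,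 that is, the saddle point over $x_a\in\mathcal{X}_{a,1}\times\cdots\times\mathcal{X}_{a,N}$ (minimizing) and $x_b\in\mathcal{X}_{b,1}\times\cdots\times\mathcal{X}_{b,N}$ (maximizing) of $$\sum_{i=1}^N f_i(x_{a,i},x_{b,i})+(\lambda_a^k)^\top(x_a-z_a^k)+\frac{\rho_a}{2}\|x_a-z_a^k\|_2^2-(\lambda_b^k)^\top(x_b-z_b^k)-\frac{\rho_b}{2}\|x_b-z_b^k\|_2^2;$$ (ii) $z_a^{k+1}=\arg\min_{z_a}\hat{\mathcal{L}}(x_a^{k+1},x_b^{k+1},z_a,z_b^k,\lambda_a^k,\lambda_b^k)$, i.e. $z_a^{k+1}=\arg\min_{z_a\in\mathcal{X}_a}\|x_a^{k+1}+\lambda_a^k/\rho_a-z_a\|_2^2$; (iii) $z_b^{k+1}=\arg\max_{z_b}\hat{\mathcal{L}}(x_a^{k+1},x_b^{k+1},z_a^{k+1},z_b,\lambda_a^k,\lambda_b^k)$, i.e. $z_b^{k+1}=\arg\min_{z_b\in\mathcal{X}_b}\|x_b^{k+1}+\lambda_b^k/\rho_b-z_b\|_2^2$; (iv) $\lambda_a^{k+1}=\lambda_a^k+\rho_a(x_a^{k+1}-z_a^{k+1})$ and $\lambda_b^{k+1}=\lambda_b^k+\rho_b(x_b^{k+1}-z_b^{k+1})$. A saddle point of the constrained min-max problem is a pair $(\bar x_a,\bar x_b)$ with $\bar x_a\in F_a:=\mathcal{X}_a\cap(\mathcal{X}_{a,1}\times\cdots\times\mathcal{X}_{a,N})$ and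 $\bar x_b\in F_b:=\mathcal{X}_b\cap(\mathcal{X}_{b,1}\times\cdots\times\mathcal{X}_{b,N})$ such that $\sum_i f_i(\bar x_{a,i},x_{b,i})\le\sum_i f_i(\bar x_{a,i},\bar x_{b,i})\le\sum_i f_i(x_{a,i},\bar x_{b,i})$ for all $x_a\in F_a$, $x_b\in F_b$. *)

theory Defs
  imports "HOL-Analysis.Analysis"
begin

text \<open>
  A partition of the coordinates of a vector into blocks is given by a function \<open>\<beta>\<close> mapping each
  coordinate to the number of its block. The space of \<open>i\<close>-th blocks, of dimension
  \<open>card {j. \<beta> j = i}\<close>, is realised as the coordinate subspace \<open>block_space \<beta> i\<close>, so that blocks of
  different dimensions live in one type and the block dimensions add up to \<open>CARD('n)\<close>.
\<close>

definition block_space :: "('n::finite \<Rightarrow> nat) \<Rightarrow> nat \<Rightarrow> (real^'n) set" where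
  "block_space \<beta> i = {v. \<forall>j. \<beta> j \<noteq> i \<longrightarrow> v $ j = 0}"

definition block :: "('n::finite \<Rightarrow> nat) \<Rightarrow> nat \<Rightarrow> real^'n \<Rightarrow> real^'n" where
  "block \<beta> i x = (\<chi> j. if \<beta> j = i then x $ j else 0)"

definition block_product ::
    "('n::finite \<Rightarrow> nat) \<Rightarrow> nat \<Rightarrow> (nat \<Rightarrow> (real^'n) set) \<Rightarrow> (real^'n) set" where
  "block_product \<beta> N X = {x. \<forall>i\<in>{1..N}. block \<beta> i x \<in> X i}"

definition lsc_on :: "'a::topological_space set \<Rightarrow> ('a \<Rightarrow> real) \<Rightarrow> bool" where
  "lsc_on S g \<longleftrightarrow> (\<forall>x\<in>S. \<forall>c<g x. \<forall>\<^sub>F y in at x within S. c < g y)"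

definition usc_on :: "'a::topological_space set \<Rightarrow> ('a \<Rightarrow> real) \<Rightarrow> bool" where
  "usc_on S g \<longleftrightarrow> (\<forall>x\<in>S. \<forall>c>g x. \<forall>\<^sub>F y in at x within S. g y < c)"

definition saddle_point_on :: "'a set \<Rightarrow> 'b set \<Rightarrow> ('a \<Rightarrow> 'b \<Rightarrow> 'c::order) \<Rightarrow> 'a \<Rightarrow> 'b \<Rightarrow> bool" where
  "saddle_point_on A B \<phi> x y \<longleftrightarrow>
     x \<in> A \<and> y \<in> B \<and> (\<forall>v\<in>B. \<phi> x v \<le> \<phi> x y) \<and> (\<forall>u\<in>A. \<phi> x y \<le> \<phi> u y)"

definition ind :: "'a set \<Rightarrow> 'a \<Rightarrow> ereal" where
  "ind X x = (if x \<in> X then 0 else \<infinity>)"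

text \<open>
  Data of the problem: number of blocks, block partitions, the functions \<open>f\<^sub>i\<close> (only their values on
  \<open>XAi i \<times> XBi i\<close> matter), the local constraint sets and the global constraint sets.
\<close>

record ('na, 'nb) minmax_problem =
  nblocks :: nat
  blkA :: "'na \<Rightarrow> nat"
  blkB :: "'nb \<Rightarrow> nat"
  cost :: "nat \<Rightarrow> real^'na \<Rightarrow> real^'nb \<Rightarrow> real"
  XAi :: "nat \<Rightarrow> (real^'na) set"
  XBi :: "nat \<Rightarrow> (real^'nb) set"
  XA :: "(real^'na) set"
  XB :: "(real^'nb) set"

definition prodA :: "('na::finite, 'nb::finite) minmax_problem \<Rightarrow> (real^'na) set" where
  "prodA P = block_product (blkA P) (nblocks P) (XAi P)"

definition prodB :: "('na::finite, 'nb::finite) minmax_problem \<Rightarrow> (real^'nb) set" where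
  "prodB P = block_product (blkB P) (nblocks P) (XBi P)"

definition total_cost ::
    "('na::finite, 'nb::finite) minmax_problem \<Rightarrow> real^'na \<Rightarrow> real^'nb \<Rightarrow> real" where
  "total_cost P xa xb =
     (\<Sum>i=1..nblocks P. cost P i (block (blkA P) i xa) (block (blkB P) i xb))"

text \<open>
  Addition on \<^typ>\<open>ereal\<close> satisfies \<open>\<infinity> + (-\<infinity>) = \<infinity>\<close>. Hence the value is \<open>\<infinity>\<close> if only the minimizer's
  variables are infeasible, \<open>-\<infinity>\<close> if only the maximizer's are, and finite if and only if all are
  feasible. If both are infeasible the value is \<open>\<infinity>\<close>; this case does not occur in the
  algorithm nor in saddle-point inequalities at a point where the Lagrangian is finite.
\<close>

definition lagrangian :: "('na::finite, 'nb::finite) minmax_problem \<Rightarrow>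
    real^'na \<Rightarrow> real^'nb \<Rightarrow> real^'na \<Rightarrow> real^'nb \<Rightarrow> real^'na \<Rightarrow> real^'nb \<Rightarrow> ereal" where
  "lagrangian P xa xb za zb la lb =
     (\<Sum>i=1..nblocks P.
        ereal (cost P i (block (blkA P) i xa) (block (blkB P) i xb))
        + ind (XAi P i) (block (blkA P) i xa) - ind (XBi P i) (block (blkB P) i xb))
     + ereal (la \<bullet> (xa - za)) + ind (XA P) za
     - ereal (lb \<bullet> (xb - zb)) - ind (XB P) zb"

definition aug_lagrangian :: "('na::finite, 'nb::finite) minmax_problem \<Rightarrow> real \<Rightarrow> real \<Rightarrow>
    real^'na \<Rightarrow> real^'nb \<Rightarrow> real^'na \<Rightarrow> real^'nb \<Rightarrow> real^'na \<Rightarrow> real^'nb \<Rightarrow> ereal" where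
  "aug_lagrangian P \<rho>a \<rho>b xa xb za zb la lb =
     lagrangian P xa xb za zb la lb
     + ereal (\<rho>a / 2 * (norm (xa - za))\<^sup>2) - ereal (\<rho>b / 2 * (norm (xb - zb))\<^sup>2)"

definition sp_admm :: "('na::finite, 'nb::finite) minmax_problem \<Rightarrow> real \<Rightarrow> real \<Rightarrow>
    (nat \<Rightarrow> real^'na) \<Rightarrow> (nat \<Rightarrow> real^'nb) \<Rightarrow> (nat \<Rightarrow> real^'na) \<Rightarrow> (nat \<Rightarrow> real^'nb) \<Rightarrow>
    (nat \<Rightarrow> real^'na) \<Rightarrow> (nat \<Rightarrow> real^'nb) \<Rightarrow> bool" where
  "sp_admm P \<rho>a \<rho>b xa xb za zb la lb \<longleftrightarrow>
     xa 0 \<in> prodA P \<and> xb 0 \<in> prodB P \<and> za 0 \<in> XA P \<and> zb 0 \<in> XB P \<and>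
     (\<forall>k.
        saddle_point_on (prodA P) (prodB P)
          (\<lambda>u v. aug_lagrangian P \<rho>a \<rho>b u v (za k) (zb k) (la k) (lb k))
          (xa (Suc k)) (xb (Suc k)) \<and>
        is_arg_min
          (\<lambda>u. aug_lagrangian P \<rho>a \<rho>b (xa (Suc k)) (xb (Suc k)) u (zb k) (la k) (lb k))
          (\<lambda>_. True) (za (Suc k)) \<and>
        is_arg_max
          (\<lambda>v. aug_lagrangian P \<rho>a \<rho>b (xa (Suc k)) (xb (Suc k)) (za (Suc k)) v (la k) (lb k))
          (\<lambda>_. True) (zb (Suc k)) \<and>
        la (Suc k) = la k + \<rho>a *\<^sub>R (xa (Suc k) - za (Suc k)) \<and>
        lb (Suc k) = lb k + \<rho>b *\<^sub>R (xb (Suc k) - zb (Suc k)))"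

end

theory Submission
  imports Defs
begin

text \<open>
  Combining the two inequalities of each saddle point turns it into a single variational
  inequality: with total cost \<open>F\<close>, each iterate satisfies
  \<open>F x v \<le> F u y + g \<bullet> (u - x) + h \<bullet> (v - y)\<close> for all feasible \<open>u, v\<close>, where \<open>g\<close>, \<open>h\<close> are the
  new multipliers up to the vanishing terms \<open>\<rho> (z\<^sup>k\<^sup>+\<^sup>1 - z\<^sup>k)\<close>, and the new multipliers are normal
  to the global constraint sets at the new \<open>z\<close>. A saddle point of the Lagrangian satisfies the same
  inequality with the multipliers themselves. Testing each inequality with the other point cancels
  all values of \<open>F\<close>, so that \<open>\<Sum> \<rho> |z - z\<^sup>*|\<^sup>2 + |\<lambda> - \<lambda>\<^sup>*|\<^sup>2 / \<rho>\<close> decreases from the first iterate on,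
  by at least the squared step lengths. Hence the steps vanish, semicontinuity makes every cluster
  point a solution of the variational inequality, and monotonicity of the distance to that
  cluster point gives convergence of the whole sequence.
\<close>

section \<open>Semicontinuity\<close>

lemma usc_on_iff_lsc_on_uminus: "usc_on S g \<longleftrightarrow> lsc_on S (\<lambda>x. - g x)"
proof -
  have neg: "(\<forall>c>a. Q c) \<longleftrightarrow> (\<forall>c. c < - a \<longrightarrow> Q (- c))" for a :: real and Q
    by (metis minus_minus neg_less_iff_less)
  have "r < - c \<longleftrightarrow> c < - r" for r c :: real by linarith
  then show ?thesis unfolding usc_on_def lsc_on_def neg by simp
qed

text \<open>The center itself satisfies \<open>c < g x\<close>, so the punctured filter may be
  replaced by \<open>nhds x\<close>. In this form the condition can be pulled back along maps and
  sequences that attain the value \<open>x\<close> at other arguments.\<close>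

lemma lsc_on_iff_nhds:
  "lsc_on S g \<longleftrightarrow> (\<forall>x\<in>S. \<forall>c<g x. \<forall>\<^sub>F y in nhds x. y \<in> S \<longrightarrow> c < g y)"
proof -
  have "(\<forall>\<^sub>F y in at x within S. c < g y) \<longleftrightarrow> (\<forall>\<^sub>F y in nhds x. y \<in> S \<longrightarrow> c < g y)"
    if "c < g x" for x c
    unfolding eventually_at_filter using that by (intro eventually_cong always_eventually) auto
  then show ?thesis unfolding lsc_on_def by blast
qed

lemma lsc_on_compose:
  assumes "lsc_on T g" and "continuous_on S h" and "h ` S \<subseteq> T"
  shows "lsc_on S (\<lambda>x. g (h x))"
  unfolding lsc_on_def
proof (intro ballI allI impI)
  fix x c assume x: "x \<in> S" and c: "c < g (h x)"
  have "\<forall>\<^sub>F y in nhds (h x). y \<in> T \<longrightarrow> c < g y"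
    using assms x c unfolding lsc_on_iff_nhds by blast
  moreover have "(h \<longlongrightarrow> h x) (at x within S)"
    using assms(2) x by (simp add: continuous_on_def)
  ultimately have "\<forall>\<^sub>F y in at x within S. h y \<in> T \<longrightarrow> c < g (h y)"
    by (auto simp: filterlim_iff)
  moreover have "\<forall>\<^sub>F y in at x within S. y \<in> S"
    by (simp add: eventually_at_filter)
  ultimately show "\<forall>\<^sub>F y in at x within S. c < g (h y)"
    by eventually_elim (use assms(3) in auto)
qed

lemma lsc_on_add:
  assumes "lsc_on S g" and "lsc_on S h"
  shows "lsc_on S (\<lambda>x. g x + h x)"
  unfolding lsc_on_def
proof (intro ballI allI impI)
  fix x c assume x: "x \<in> S" and c: "c < g x + h x"
  define d where "d = (g x + h x - c) / 2"
  have d: "d > 0" using c by (simp add: d_def)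
  have "\<forall>\<^sub>F y in at x within S. g x - d < g y" "\<forall>\<^sub>F y in at x within S. h x - d < h y"
    using assms x d by (auto simp: lsc_on_def)
  then show "\<forall>\<^sub>F y in at x within S. c < g y + h y"
    by eventually_elim (simp add: d_def field_simps)
qed

lemma lsc_on_sum:
  assumes "\<And>i. i \<in> I \<Longrightarrow> lsc_on S (g i)"
  shows "lsc_on S (\<lambda>x. \<Sum>i\<in>I. g i x)"
  using assms
proof (induction I rule: infinite_finite_induct)
  case (insert i I)
  then show ?case by (simp add: lsc_on_add)
qed (simp_all add: lsc_on_def)

lemma lsc_on_sequentially:
  assumes "lsc_on S g" and "x \<in> S" and "s \<longlonglongrightarrow> x" and "\<And>n. s n \<in> S" and "c < g x"
  shows "\<forall>\<^sub>F n in sequentially. c < g (s n)"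
proof -
  have "\<forall>\<^sub>F y in nhds x. y \<in> S \<longrightarrow> c < g y"
    using assms unfolding lsc_on_iff_nhds by blast
  then have "\<forall>\<^sub>F n in sequentially. s n \<in> S \<longrightarrow> c < g (s n)"
    using assms(3) by (auto simp: filterlim_iff)
  then show ?thesis using assms(4) by simp
qed

section \<open>Block structure\<close>

lemma linear_block: "linear (block \<beta> i)"
  by (auto simp: block_def vec_eq_iff intro!: linearI)

lemma continuous_on_block: "continuous_on S (block \<beta> i)"
  by (simp add: linear_block linear_continuous_on linear_conv_bounded_linear[symmetric])

text \<open>Each block map is linear and continuous, so convexity and closedness of the product
  follow from the closure of these properties under preimages and intersections.\<close>

lemma block_product_INT: "block_product \<beta> N X = (\<Inter>i\<in>{1..N}. block \<beta> i -` X i)"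
  by (auto simp: block_product_def)

lemma convex_block_product:
  assumes "\<And>i. i \<in> {1..N} \<Longrightarrow> convex (X i)"
  shows "convex (block_product \<beta> N X)"
  unfolding block_product_INT
  by (intro convex_INT convex_linear_vimage linear_block assms)

lemma closed_block_product:
  assumes "\<And>i. i \<in> {1..N} \<Longrightarrow> closed (X i)"
  shows "closed (block_product \<beta> N X)"
  unfolding block_product_INT
  by (intro closed_INT ballI closed_vimage assms continuous_on_block)

lemma convex_on_block_sum:
  assumes "\<And>i. i \<in> {1..N} \<Longrightarrow> convex_on (X i) (g i)"
  shows "convex_on (block_product \<beta> N X) (\<lambda>x. \<Sum>i=1..N. g i (block \<beta> i x))"
proof -
  have conv: "convex (block_product \<beta> N X)"
    using assms by (intro convex_block_product convex_on_imp_convex) auto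
  show ?thesis
  proof (rule convex_onI[OF _ conv])
    fix t :: real and x y
    assume t: "0 < t" "t < 1" and x: "x \<in> block_product \<beta> N X" and y: "y \<in> block_product \<beta> N X"
    have "g i (block \<beta> i ((1 - t) *\<^sub>R x + t *\<^sub>R y))
        \<le> (1 - t) * g i (block \<beta> i x) + t * g i (block \<beta> i y)" if "i \<in> {1..N}" for i
    proof -
      have "block \<beta> i ((1 - t) *\<^sub>R x + t *\<^sub>R y) = (1 - t) *\<^sub>R block \<beta> i x + t *\<^sub>R block \<beta> i y"
        by (simp add: linear_block linear_add linear_scale)
      moreover have "block \<beta> i x \<in> X i" "block \<beta> i y \<in> X i"
        using x y that by (auto simp: block_product_def)
      ultimately show ?thesis
        using convex_onD[OF assms[OF that], of t "block \<beta> i x" "block \<beta> i y"] t by simp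
    qed
    then have "(\<Sum>i=1..N. g i (block \<beta> i ((1 - t) *\<^sub>R x + t *\<^sub>R y)))
      \<le> (\<Sum>i=1..N. (1 - t) * g i (block \<beta> i x) + t * g i (block \<beta> i y))"
      by (rule sum_mono)
    then show "(\<Sum>i=1..N. g i (block \<beta> i ((1 - t) *\<^sub>R x + t *\<^sub>R y)))
      \<le> (1 - t) * (\<Sum>i=1..N. g i (block \<beta> i x)) + t * (\<Sum>i=1..N. g i (block \<beta> i y))"
      by (simp add: sum.distrib sum_distrib_left)
  qed
qed

lemma lsc_on_block_sum:
  assumes "\<And>i. i \<in> {1..N} \<Longrightarrow> lsc_on (X i) (g i)"
  shows "lsc_on (block_product \<beta> N X) (\<lambda>x. \<Sum>i=1..N. g i (block \<beta> i x))"
  by (intro lsc_on_sum lsc_on_compose[OF assms] continuous_on_block)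
     (auto simp: block_product_def)

section \<open>Variational inequalities\<close>

definition normal_cone :: "'a::real_inner set \<Rightarrow> 'a \<Rightarrow> 'a set" where
  "normal_cone X z = {l. \<forall>w\<in>X. l \<bullet> (w - z) \<le> 0}"

lemma normal_cone_limit:
  assumes "l \<longlonglongrightarrow> l'" and "z \<longlonglongrightarrow> z'" and "\<And>k. l k \<in> normal_cone X (z k)"
  shows "l' \<in> normal_cone X z'"
  unfolding normal_cone_def
proof (intro CollectI ballI)
  fix w assume "w \<in> X"
  then have "l k \<bullet> (w - z k) \<le> 0" for k using assms(3) by (auto simp: normal_cone_def)
  moreover have "(\<lambda>k. l k \<bullet> (w - z k)) \<longlonglongrightarrow> l' \<bullet> (w - z')"
    by (intro tendsto_intros assms)
  ultimately show "l' \<bullet> (w - z') \<le> 0" by (intro LIMSEQ_le_const2) auto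
qed

text \<open>First-order optimality without derivatives of \<open>g\<close>: move from
  \<open>x\<close> a fraction \<open>t\<close> of the way to \<open>u\<close>. Convexity bounds
  \<open>g\<close> by its chord and the quadratic penalty adds only a term of order
  \<open>t^2\<close> beyond its linear part; dividing by \<open>t\<close> and letting
  \<open>t\<close> tend to 0 from the right leaves the claim.\<close>

lemma proximal_minimizer_variational_inequality:
  fixes g :: "'a::real_inner \<Rightarrow> real"
  assumes g: "convex_on A g" and x: "x \<in> A" and u: "u \<in> A"
    and min: "\<And>v. v \<in> A \<Longrightarrow>
      g x + l \<bullet> (x - z) + \<rho> / 2 * (norm (x - z))\<^sup>2 \<le> g v + l \<bullet> (v - z) + \<rho> / 2 * (norm (v - z))\<^sup>2"
  shows "g x \<le> g u + (l + \<rho> *\<^sub>R (x - z)) \<bullet> (u - x)"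
proof -
  define c where "c = g u - g x + (l + \<rho> *\<^sub>R (x - z)) \<bullet> (u - x)"
  define d where "d = \<rho> / 2 * (norm (u - x))\<^sup>2"
  have pos: "0 \<le> c + t * d" if t: "0 < t" "t < 1" for t :: real
  proof -
    define v where "v = (1 - t) *\<^sub>R x + t *\<^sub>R u"
    have vA: "v \<in> A"
      unfolding v_def using convex_on_imp_convex[OF g] x u t by (intro convexD) auto
    have vx: "v - z = (x - z) + t *\<^sub>R (u - x)" by (simp add: v_def algebra_simps)
    have 1: "g v \<le> (1 - t) * g x + t * g u"
      unfolding v_def using convex_onD[OF g, of t x u] x u t by simp
    have 2: "(norm (v - z))\<^sup>2
        = (norm (x - z))\<^sup>2 + 2 * t * ((x - z) \<bullet> (u - x)) + t\<^sup>2 * (norm (u - x))\<^sup>2"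
      unfolding vx power2_norm_eq_inner
      by (simp add: inner_add_left inner_add_right inner_commute power2_eq_square)
    have 3: "l \<bullet> (v - z) = l \<bullet> (x - z) + t * (l \<bullet> (u - x))"
      unfolding vx by (simp add: inner_add_right)
    have "0 \<le> t * (g u - g x) + t * (l \<bullet> (u - x))
        + \<rho> / 2 * (2 * t * ((x - z) \<bullet> (u - x)) + t\<^sup>2 * (norm (u - x))\<^sup>2)"
      using min[OF vA, unfolded 2 3] 1 by (simp only: ring_distribs)
    also have "\<dots> = t * (c + t * d)"
      unfolding c_def d_def by (simp add: inner_add_left algebra_simps power2_eq_square)
    finally have "0 \<le> t * (c + t * d)" .
    then show ?thesis using t by (simp add: zero_le_mult_iff)
  qed
  have "((\<lambda>t. c + t * d) \<longlongrightarrow> c + 0 * d) (at_right 0)"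
    by (intro tendsto_intros)
  moreover have "\<forall>\<^sub>F t in at_right 0. 0 \<le> c + t * d"
    using eventually_at_right_real[of 0 1] by (rule eventually_mono) (auto intro: pos)
  ultimately have "0 \<le> c" by (simp add: tendsto_lowerbound)
  then show ?thesis by (simp add: c_def)
qed

text \<open>The weights \<open>\<rho>\<close> and \<open>1 / \<rho>\<close> are those for which
  substituting the multiplier update produces matching inner products. With a solution as reference
  \<open>(z', l')\<close> this measures the distance to it; with the previous iterate as reference
  it measures the step.\<close>

definition merit :: "real \<Rightarrow> 'a::real_inner \<Rightarrow> 'a \<Rightarrow> 'a \<Rightarrow> 'a \<Rightarrow> real" where
  "merit \<rho> z' l' z l = \<rho> * (norm (z - z'))\<^sup>2 + (norm (l - l'))\<^sup>2 / \<rho>"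

lemma merit_nonneg: "\<rho> > 0 \<Longrightarrow> 0 \<le> merit \<rho> z' l' z l"
  by (simp add: merit_def)

lemma tendsto_merit:
  assumes "\<rho> > 0" and "(z \<longlongrightarrow> z0) F" and "(l \<longlongrightarrow> l0) F"
    and "(z' \<longlongrightarrow> z0') F" and "(l' \<longlongrightarrow> l0') F"
  shows "((\<lambda>k. merit \<rho> (z' k) (l' k) (z k) (l k)) \<longlongrightarrow> merit \<rho> z0' l0' z0 l0) F"
  unfolding merit_def using assms(1) by (intro tendsto_intros assms(2-)) auto

lemma norm_sq_le_merit:
  assumes "\<rho> > 0"
  shows "(norm (z - z'))\<^sup>2 \<le> merit \<rho> z' l' z l / \<rho>" and "(norm (l - l'))\<^sup>2 \<le> merit \<rho> z' l' z l * \<rho>"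
  using assms by (simp_all add: merit_def field_simps)

lemma bounded_of_norm_diff_sq_le:
  fixes f :: "nat \<Rightarrow> 'a::real_normed_vector"
  assumes "\<And>k. (norm (f k - c))\<^sup>2 \<le> C"
  shows "bounded (range f)"
proof -
  have "norm (f k) \<le> norm c + sqrt C" for k
    using real_le_rsqrt[OF assms[of k]] norm_triangle_ineq[of c "f k - c"] by simp
  then show ?thesis by (auto simp: bounded_iff)
qed

lemma tendsto_zero_of_norm_sq_le:
  fixes f :: "'b \<Rightarrow> 'a::real_normed_vector"
  assumes "\<And>k. (norm (f k))\<^sup>2 \<le> h k" and "(h \<longlongrightarrow> 0) F"
  shows "(f \<longlongrightarrow> 0) F"
proof -
  have "((\<lambda>k. (norm (f k))\<^sup>2) \<longlongrightarrow> 0) F"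
    by (rule tendsto_sandwich[OF _ _ tendsto_const assms(2)]) (auto intro: always_eventually assms(1))
  then have "((\<lambda>k. sqrt ((norm (f k))\<^sup>2)) \<longlongrightarrow> sqrt 0) F" by (rule tendsto_real_sqrt)
  then show ?thesis by (simp add: tendsto_norm_zero_iff)
qed

lemma merit_tendsto_zero:
  assumes "\<rho> > 0" and "((\<lambda>k. merit \<rho> (z' k) (l' k) (z k) (l k)) \<longlongrightarrow> 0) F"
  shows "((\<lambda>k. z k - z' k) \<longlongrightarrow> 0) F" and "((\<lambda>k. l k - l' k) \<longlongrightarrow> 0) F"
  by (rule tendsto_zero_of_norm_sq_le, rule norm_sq_le_merit[OF assms(1)],
      use tendsto_mult_left_zero[OF assms(2), of "inverse \<rho>"] in \<open>simp add: divide_inverse\<close>)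
     (rule tendsto_zero_of_norm_sq_le, rule norm_sq_le_merit[OF assms(1)],
      use tendsto_mult_left_zero[OF assms(2), of \<rho>] in simp)

text \<open>The polarization identity \<open>three\<close> turns the change of merit into inner
  products, and the multiplier update expresses \<open>x1 - z1\<close> by \<open>l1 - l0\<close>.
  What remains besides the stated excess is \<open>(l1 - ls) \<bullet> (z1 - zs)\<close> and
  \<open>(z1 - z0) \<bullet> (l1 - l0)\<close>; both are nonnegative because the normal cone is a
  monotone operator.\<close>

lemma merit_step:
  fixes x1 z0 z1 l0 l1 zs ls :: "'a::real_inner"
  assumes \<rho>: "\<rho> > 0" and step: "l1 = l0 + \<rho> *\<^sub>R (x1 - z1)"
    and X: "z0 \<in> X" "z1 \<in> X" "zs \<in> X"
    and N: "l0 \<in> normal_cone X z0" "l1 \<in> normal_cone X z1" "ls \<in> normal_cone X zs"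
  shows "merit \<rho> zs ls z1 l1 + merit \<rho> z0 l0 z1 l1
    \<le> merit \<rho> zs ls z0 l0 + 2 * ((l1 - ls + \<rho> *\<^sub>R (z1 - z0)) \<bullet> (x1 - zs))"
proof -
  have n: "l0 \<bullet> (z1 - z0) \<le> 0" "l1 \<bullet> (z0 - z1) \<le> 0" "l1 \<bullet> (zs - z1) \<le> 0" "ls \<bullet> (z1 - zs) \<le> 0"
    using N X by (auto simp: normal_cone_def)
  have three: "(norm (p - s))\<^sup>2 + (norm (p - q))\<^sup>2 - (norm (q - s))\<^sup>2 = 2 * ((p - s) \<bullet> (p - q))"
    for p q s :: 'a
    unfolding power2_norm_eq_inner by (simp add: algebra_simps inner_commute)
  have x1: "x1 = z1 + (1 / \<rho>) *\<^sub>R (l1 - l0)" using step \<rho> by simp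
  have "merit \<rho> zs ls z1 l1 + merit \<rho> z0 l0 z1 l1 - merit \<rho> zs ls z0 l0
    = \<rho> * ((norm (z1 - zs))\<^sup>2 + (norm (z1 - z0))\<^sup>2 - (norm (z0 - zs))\<^sup>2)
      + ((norm (l1 - ls))\<^sup>2 + (norm (l1 - l0))\<^sup>2 - (norm (l0 - ls))\<^sup>2) / \<rho>"
    unfolding merit_def by (simp add: diff_divide_distrib add_divide_distrib algebra_simps)
  also have "\<dots> = 2 * (\<rho> * ((z1 - zs) \<bullet> (z1 - z0)) + ((l1 - ls) \<bullet> (l1 - l0)) / \<rho>)"
    unfolding three by simp
  also have "\<dots> = 2 * ((l1 - ls + \<rho> *\<^sub>R (z1 - z0)) \<bullet> (x1 - zs)
      - (l1 - ls) \<bullet> (z1 - zs) - (z1 - z0) \<bullet> (l1 - l0))"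
  proof -
    have *: "x1 - zs = (z1 - zs) + (1 / \<rho>) *\<^sub>R (l1 - l0)" using x1 by simp
    show ?thesis
      unfolding * using \<rho>
      by (simp only: inner_add_left inner_add_right inner_scaleR_left inner_scaleR_right inner_commute)
         (simp add: field_simps inner_commute)
  qed
  also have "\<dots> \<le> 2 * ((l1 - ls + \<rho> *\<^sub>R (z1 - z0)) \<bullet> (x1 - zs))"
    using n by (simp add: inner_diff_left inner_diff_right inner_commute)
  finally show ?thesis by simp
qed

section \<open>Convergence of the variational iteration\<close>

text \<open>The algorithm in real arithmetic: the primal step enters through one variational
  inequality, the two projections through normality of the multipliers. Normality is required at
  index 0 as well, since \<open>merit_step\<close> uses it at both ends of a step.\<close>

locale saddle_admm =
  fixes A X :: "'a::euclidean_space set" and B Y :: "'b::euclidean_space set"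
    and F :: "'a \<Rightarrow> 'b \<Rightarrow> real" and \<rho>a \<rho>b :: real
    and xa za la :: "nat \<Rightarrow> 'a" and xb zb lb :: "nat \<Rightarrow> 'b"
  assumes closed: "closed A" "closed B" "closed X" "closed Y"
    and lsc: "\<And>v. v \<in> B \<Longrightarrow> lsc_on A (\<lambda>u. F u v)"
    and usc: "\<And>u. u \<in> A \<Longrightarrow> usc_on B (F u)"
    and \<rho>a: "\<rho>a > 0" and \<rho>b: "\<rho>b > 0"
    and x_mem: "\<And>k. xa k \<in> A" "\<And>k. xb k \<in> B"
    and z_mem: "\<And>k. za k \<in> X" "\<And>k. zb k \<in> Y"
    and normal: "\<And>k. la k \<in> normal_cone X (za k)" "\<And>k. lb k \<in> normal_cone Y (zb k)"
    and la_step: "\<And>k. la (Suc k) = la k + \<rho>a *\<^sub>R (xa (Suc k) - za (Suc k))"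
    and lb_step: "\<And>k. lb (Suc k) = lb k + \<rho>b *\<^sub>R (xb (Suc k) - zb (Suc k))"
    and x_step: "\<And>k u v. u \<in> A \<Longrightarrow> v \<in> B \<Longrightarrow> F (xa (Suc k)) v \<le> F u (xb (Suc k))
      + (la (Suc k) + \<rho>a *\<^sub>R (za (Suc k) - za k)) \<bullet> (u - xa (Suc k))
      + (lb (Suc k) + \<rho>b *\<^sub>R (zb (Suc k) - zb k)) \<bullet> (v - xb (Suc k))"
begin

text \<open>Optimality conditions for a saddle point of the Lagrangian with both copies of each
  variable identified. The two saddle inequalities are merged so that \<open>F x y\<close> drops
  out: \<open>F\<close> is only separately semicontinuous, so its values along the iterates need not
  converge, while the two remaining values have the semicontinuity that a limit requires.\<close>

definition kkt :: "'a \<Rightarrow> 'b \<Rightarrow> 'a \<Rightarrow> 'b \<Rightarrow> bool" where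
  "kkt x y l m \<longleftrightarrow> x \<in> A \<inter> X \<and> y \<in> B \<inter> Y \<and> l \<in> normal_cone X x \<and> m \<in> normal_cone Y y \<and>
     (\<forall>u\<in>A. \<forall>v\<in>B. F x v \<le> F u y + l \<bullet> (u - x) + m \<bullet> (v - y))"

text \<open>Putting \<open>u = x\<close> or \<open>v = y\<close> removes one linear term; the other
  is nonpositive on the global constraint set by normality.\<close>

lemma kkt_saddle_point:
  assumes "kkt x y l m"
  shows "saddle_point_on (X \<inter> A) (Y \<inter> B) F x y"
  unfolding saddle_point_on_def
proof (intro conjI ballI)
  fix v assume "v \<in> Y \<inter> B"
  moreover from this have "m \<bullet> (v - y) \<le> 0" using assms by (auto simp: kkt_def normal_cone_def)
  moreover have "F x v \<le> F x y + l \<bullet> (x - x) + m \<bullet> (v - y)"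
    using assms \<open>v \<in> Y \<inter> B\<close> unfolding kkt_def by blast
  ultimately show "F x v \<le> F x y" by simp
next
  fix u assume "u \<in> X \<inter> A"
  moreover from this have "l \<bullet> (u - x) \<le> 0" using assms by (auto simp: kkt_def normal_cone_def)
  moreover have "F x y \<le> F u y + l \<bullet> (u - x) + m \<bullet> (y - y)"
    using assms \<open>u \<in> X \<inter> A\<close> unfolding kkt_def by blast
  ultimately show "F x y \<le> F u y" by simp
qed (use assms in \<open>auto simp: kkt_def\<close>)

section \<open>Decrease of the distance to a solution and vanishing steps\<close>

abbreviation total_merit :: "'a \<Rightarrow> 'b \<Rightarrow> 'a \<Rightarrow> 'b \<Rightarrow> nat \<Rightarrow> real" where
  "total_merit x y l m k \<equiv> merit \<rho>a x l (za k) (la k) + merit \<rho>b y m (zb k) (lb k)"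

abbreviation step_length :: "nat \<Rightarrow> real" where
  "step_length k \<equiv> total_merit (za k) (zb k) (la k) (lb k) (Suc k)"

text \<open>Testing the step inequality at \<open>(x, y)\<close> and the \<open>kkt\<close>
  inequality at the new primal iterate cancels all values of \<open>F\<close>. This bounds only the
  sum of the two excess terms from \<open>merit_step\<close>, so the minimizer's and the maximizer's
  merits have to be added.\<close>

lemma total_merit_step:
  assumes "kkt x y l m"
  shows "total_merit x y l m (Suc k) + step_length k \<le> total_merit x y l m k"
proof -
  let ?ga = "la (Suc k) + \<rho>a *\<^sub>R (za (Suc k) - za k)" and ?gb = "lb (Suc k) + \<rho>b *\<^sub>R (zb (Suc k) - zb k)"
  have mem: "x \<in> A" "x \<in> X" "y \<in> B" "y \<in> Y" "l \<in> normal_cone X x" "m \<in> normal_cone Y y"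
    using assms by (auto simp: kkt_def)
  have "F (xa (Suc k)) y \<le> F x (xb (Suc k)) + ?ga \<bullet> (x - xa (Suc k)) + ?gb \<bullet> (y - xb (Suc k))"
    using x_step mem by blast
  moreover have "F x (xb (Suc k)) \<le> F (xa (Suc k)) y + l \<bullet> (xa (Suc k) - x) + m \<bullet> (xb (Suc k) - y)"
    using assms x_mem unfolding kkt_def by blast
  ultimately have "(?ga - l) \<bullet> (xa (Suc k) - x) + (?gb - m) \<bullet> (xb (Suc k) - y) \<le> 0"
    by (simp add: inner_diff_left inner_diff_right)
  moreover have "?ga - l = la (Suc k) - l + \<rho>a *\<^sub>R (za (Suc k) - za k)"
    "?gb - m = lb (Suc k) - m + \<rho>b *\<^sub>R (zb (Suc k) - zb k)" by simp_all
  ultimately have "(la (Suc k) - l + \<rho>a *\<^sub>R (za (Suc k) - za k)) \<bullet> (xa (Suc k) - x)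
    + (lb (Suc k) - m + \<rho>b *\<^sub>R (zb (Suc k) - zb k)) \<bullet> (xb (Suc k) - y) \<le> 0"
    by metis
  then show ?thesis
    using merit_step[OF \<rho>a la_step z_mem(1) z_mem(1) mem(2) normal(1) normal(1) mem(5), of k]
      merit_step[OF \<rho>b lb_step z_mem(2) z_mem(2) mem(4) normal(2) normal(2) mem(6), of k]
    by linarith
qed

lemma total_merit_decseq:
  assumes "kkt x y l m"
  shows "decseq (total_merit x y l m)"
proof (rule decseq_SucI)
  show "total_merit x y l m (Suc k) \<le> total_merit x y l m k" for k
    using total_merit_step[OF assms, of k] merit_nonneg[OF \<rho>a, of "za k" "la k" "za (Suc k)" "la (Suc k)"]
      merit_nonneg[OF \<rho>b, of "zb k" "lb k" "zb (Suc k)" "lb (Suc k)"] by linarith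
qed

lemma total_merit_nonneg: "0 \<le> total_merit x y l m k"
  by (intro add_nonneg_nonneg merit_nonneg \<rho>a \<rho>b)

lemma total_merit_convergent:
  assumes "kkt x y l m"
  obtains V where "total_merit x y l m \<longlonglongrightarrow> V"
proof (rule decseq_convergent)
  show "decseq (total_merit x y l m)" by (rule total_merit_decseq[OF assms])
  show "\<forall>k. 0 \<le> total_merit x y l m k" by (intro allI total_merit_nonneg)
qed (rule that)

text \<open>The reference point may vary with \<open>k\<close> and the iterate is taken at
  \<open>r k\<close>, so that one statement serves both the step lengths (previous iterate as
  reference, \<open>r = Suc\<close>) and the distance to a fixed limit.\<close>

lemma total_merit_tendsto_zero:
  assumes "((\<lambda>k. total_merit (x k) (y k) (l k) (m k) (r k)) \<longlongrightarrow> 0) G"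
  shows "((\<lambda>k. za (r k) - x k) \<longlongrightarrow> 0) G" "((\<lambda>k. zb (r k) - y k) \<longlongrightarrow> 0) G"
    "((\<lambda>k. la (r k) - l k) \<longlongrightarrow> 0) G" "((\<lambda>k. lb (r k) - m k) \<longlongrightarrow> 0) G"
proof -
  have "((\<lambda>k. merit \<rho>a (x k) (l k) (za (r k)) (la (r k))) \<longlongrightarrow> 0) G"
    by (rule tendsto_sandwich[OF _ _ tendsto_const assms])
       (auto intro!: always_eventually merit_nonneg \<rho>a \<rho>b)
  then show "((\<lambda>k. za (r k) - x k) \<longlongrightarrow> 0) G" "((\<lambda>k. la (r k) - l k) \<longlongrightarrow> 0) G"
    by (rule merit_tendsto_zero[OF \<rho>a])+
  have "((\<lambda>k. merit \<rho>b (y k) (m k) (zb (r k)) (lb (r k))) \<longlongrightarrow> 0) G"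
    by (rule tendsto_sandwich[OF _ _ tendsto_const assms])
       (auto intro!: always_eventually merit_nonneg \<rho>a \<rho>b)
  then show "((\<lambda>k. zb (r k) - y k) \<longlongrightarrow> 0) G" "((\<lambda>k. lb (r k) - m k) \<longlongrightarrow> 0) G"
    by (rule merit_tendsto_zero[OF \<rho>b])+
qed

text \<open>The step length is at most the difference of consecutive terms of a convergent
  sequence.\<close>

lemma step_length_tendsto_zero:
  assumes "kkt x y l m"
  shows "step_length \<longlonglongrightarrow> 0"
proof -
  obtain V where V: "total_merit x y l m \<longlonglongrightarrow> V" using total_merit_convergent[OF assms] .
  have "(\<lambda>k. total_merit x y l m k - total_merit x y l m (Suc k)) \<longlonglongrightarrow> V - V"
    by (intro tendsto_diff V LIMSEQ_Suc[OF V])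
  then have lim: "(\<lambda>k. total_merit x y l m k - total_merit x y l m (Suc k)) \<longlonglongrightarrow> 0" by simp
  show ?thesis
  proof (rule tendsto_sandwich[OF _ _ tendsto_const lim])
    show "\<forall>\<^sub>F k in sequentially. 0 \<le> step_length k"
      by (intro always_eventually allI total_merit_nonneg)
    show "\<forall>\<^sub>F k in sequentially.
        step_length k \<le> total_merit x y l m k - total_merit x y l m (Suc k)"
      using total_merit_step[OF assms] by (intro always_eventually allI) (simp add: le_diff_eq add.commute)
  qed
qed

text \<open>Vanishing steps remove the differences from the step inequality, and lower
  semicontinuity in the first argument of \<open>F\<close> with upper semicontinuity in the second
  lets it pass to the limit. The limits are taken at \<open>Suc (r n)\<close> because that
  inequality relates an iterate to its predecessor.\<close>

lemma cluster_point_kkt: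
  assumes kkt: "kkt x y l m" and r: "strict_mono r"
    and lim: "(\<lambda>n. za (Suc (r n))) \<longlonglongrightarrow> x'" "(\<lambda>n. zb (Suc (r n))) \<longlonglongrightarrow> y'"
      "(\<lambda>n. la (Suc (r n))) \<longlonglongrightarrow> l'" "(\<lambda>n. lb (Suc (r n))) \<longlonglongrightarrow> m'"
  shows "kkt x' y' l' m'"
proof -
  note steps = total_merit_tendsto_zero[where r = Suc, OF step_length_tendsto_zero[OF kkt]]
  note sub = LIMSEQ_subseq_LIMSEQ[OF _ r, unfolded o_def]
  have dz: "(\<lambda>n. za (Suc (r n)) - za (r n)) \<longlonglongrightarrow> 0" "(\<lambda>n. zb (Suc (r n)) - zb (r n)) \<longlonglongrightarrow> 0"
    using sub[OF steps(1)] sub[OF steps(2)] by auto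
  \<comment> \<open>The primal iterate differs from its copy by a multiple of the vanishing
    multiplier step, so both have the same limit.\<close>
  have xza: "xa (Suc k) = za (Suc k) + (1 / \<rho>a) *\<^sub>R (la (Suc k) - la k)" for k
    using la_step[of k] \<rho>a by simp
  have xzb: "xb (Suc k) = zb (Suc k) + (1 / \<rho>b) *\<^sub>R (lb (Suc k) - lb k)" for k
    using lb_step[of k] \<rho>b by simp
  have "(\<lambda>n. za (Suc (r n)) + (1 / \<rho>a) *\<^sub>R (la (Suc (r n)) - la (r n))) \<longlonglongrightarrow> x' + (1 / \<rho>a) *\<^sub>R 0"
    by (intro tendsto_intros lim sub[OF steps(3)])
  then have limx: "(\<lambda>n. xa (Suc (r n))) \<longlonglongrightarrow> x'" using xza by simp
  have "(\<lambda>n. zb (Suc (r n)) + (1 / \<rho>b) *\<^sub>R (lb (Suc (r n)) - lb (r n))) \<longlonglongrightarrow> y' + (1 / \<rho>b) *\<^sub>R 0"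
    by (intro tendsto_intros lim sub[OF steps(4)])
  then have limy: "(\<lambda>n. xb (Suc (r n))) \<longlonglongrightarrow> y'" using xzb by simp
  have mem: "x' \<in> A" "y' \<in> B" "x' \<in> X" "y' \<in> Y"
    using closed_sequentially[OF closed(1) _ limx] closed_sequentially[OF closed(2) _ limy]
      closed_sequentially[OF closed(3) _ lim(1)] closed_sequentially[OF closed(4) _ lim(2)]
      x_mem z_mem by auto
  have "F x' v \<le> F u y' + l' \<bullet> (u - x') + m' \<bullet> (v - y')" if uv: "u \<in> A" "v \<in> B" for u v
  proof (rule ccontr)
    let ?E = "\<lambda>n. (la (Suc (r n)) + \<rho>a *\<^sub>R (za (Suc (r n)) - za (r n))) \<bullet> (u - xa (Suc (r n)))
      + (lb (Suc (r n)) + \<rho>b *\<^sub>R (zb (Suc (r n)) - zb (r n))) \<bullet> (v - xb (Suc (r n)))"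
    define E where "E = l' \<bullet> (u - x') + m' \<bullet> (v - y')"
    \<comment> \<open>A third of the supposed violation: the linear terms and the two values of
      \<open>F\<close> may each be off by less than \<open>d\<close>, which contradicts a violation
      of \<open>3 * d\<close>.\<close>
    define d where "d = (F x' v - F u y' - E) / 3"
    assume "\<not> F x' v \<le> F u y' + l' \<bullet> (u - x') + m' \<bullet> (v - y')"
    then have d: "d > 0" by (simp add: d_def E_def)
    have "?E \<longlonglongrightarrow> (l' + \<rho>a *\<^sub>R 0) \<bullet> (u - x') + (m' + \<rho>b *\<^sub>R 0) \<bullet> (v - y')"
      by (intro tendsto_intros lim dz limx limy)
    then have "?E \<longlonglongrightarrow> E" by (simp add: E_def)
    then have "\<forall>\<^sub>F n in sequentially. ?E n < E + d" using d by (intro order_tendstoD) auto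
    moreover have "\<forall>\<^sub>F n in sequentially. F x' v - d < F (xa (Suc (r n))) v"
      using lsc_on_sequentially[OF lsc[OF uv(2)] mem(1) limx x_mem(1)] d by simp
    moreover have "\<forall>\<^sub>F n in sequentially. - F u y' - d < - F u (xb (Suc (r n)))"
      using lsc_on_sequentially[OF usc[OF uv(1), unfolded usc_on_iff_lsc_on_uminus] mem(2) limy x_mem(2)] d
      by simp
    ultimately have "\<forall>\<^sub>F n in sequentially. False"
    proof eventually_elim
      case (elim n)
      then show ?case using x_step[OF uv, of "r n"] by (simp add: d_def field_simps)
    qed
    then show False by simp
  qed
  then show ?thesis
    using mem normal_cone_limit[OF lim(3,1) normal(1)] normal_cone_limit[OF lim(4,2) normal(2)]
    by (auto simp: kkt_def)
qed

text \<open>The decreasing merit controls the multipliers together with \<open>za\<close> and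
  \<open>zb\<close>; compactness of the constraint sets would say nothing about the
  multipliers.\<close>

lemma bounded_iterates:
  assumes "kkt x y l m"
  shows "bounded (range za)" "bounded (range zb)" "bounded (range la)" "bounded (range lb)"
proof -
  let ?V = "total_merit x y l m 0"
  have le: "merit \<rho>a x l (za k) (la k) \<le> ?V" "merit \<rho>b y m (zb k) (lb k) \<le> ?V" for k
    using decseqD[OF total_merit_decseq[OF assms], of 0 k]
      merit_nonneg[OF \<rho>a, of x l "za k" "la k"] merit_nonneg[OF \<rho>b, of y m "zb k" "lb k"] by linarith+
  have "(norm (za k - x))\<^sup>2 \<le> ?V / \<rho>a" for k
    using norm_sq_le_merit(1)[OF \<rho>a, where z = "za k" and l = "la k" and z' = x and l' = l]
      divide_right_mono[OF le(1)[of k] less_imp_le[OF \<rho>a]] by (rule order_trans)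
  then show "bounded (range za)" by (rule bounded_of_norm_diff_sq_le)
  have "(norm (zb k - y))\<^sup>2 \<le> ?V / \<rho>b" for k
    using norm_sq_le_merit(1)[OF \<rho>b, where z = "zb k" and l = "lb k" and z' = y and l' = m]
      divide_right_mono[OF le(2)[of k] less_imp_le[OF \<rho>b]] by (rule order_trans)
  then show "bounded (range zb)" by (rule bounded_of_norm_diff_sq_le)
  have "(norm (la k - l))\<^sup>2 \<le> ?V * \<rho>a" for k
    using norm_sq_le_merit(2)[OF \<rho>a, where z = "za k" and l = "la k" and z' = x and l' = l]
      mult_right_mono[OF le(1)[of k] less_imp_le[OF \<rho>a]] by (rule order_trans)
  then show "bounded (range la)" by (rule bounded_of_norm_diff_sq_le)
  have "(norm (lb k - m))\<^sup>2 \<le> ?V * \<rho>b" for k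
    using norm_sq_le_merit(2)[OF \<rho>b, where z = "zb k" and l = "lb k" and z' = y and l' = m]
      mult_right_mono[OF le(2)[of k] less_imp_le[OF \<rho>b]] by (rule order_trans)
  then show "bounded (range lb)" by (rule bounded_of_norm_diff_sq_le)
qed

theorem converges_to_saddle_point:
  assumes kkt: "kkt x y l m"
  shows "\<exists>x' y'. saddle_point_on (X \<inter> A) (Y \<inter> B) F x' y' \<and> za \<longlonglongrightarrow> x' \<and> zb \<longlonglongrightarrow> y'"
proof -
  define s where "s = (\<lambda>n. (za (Suc n), zb (Suc n), la (Suc n), lb (Suc n)))"
  have "bounded (range s)"
    by (rule bounded_subset[of "range za \<times> range zb \<times> range la \<times> range lb"])
       (auto simp: s_def intro: bounded_Times bounded_iterates[OF kkt])
  then obtain p r where r: "strict_mono r" and p: "(s \<circ> r) \<longlonglongrightarrow> p"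
    using bounded_imp_convergent_subsequence by blast
  obtain x' y' l' m' where "p = (x', y', l', m')" by (cases p) auto
  with p have ps: "(\<lambda>n. (za (Suc (r n)), zb (Suc (r n)), la (Suc (r n)), lb (Suc (r n)))) \<longlonglongrightarrow> (x', y', l', m')"
    by (simp add: s_def o_def)
  note p1 = tendsto_snd[OF ps, simplified]
  note p2 = tendsto_snd[OF p1, simplified]
  have lim: "(\<lambda>n. za (Suc (r n))) \<longlonglongrightarrow> x'" "(\<lambda>n. zb (Suc (r n))) \<longlonglongrightarrow> y'"
      "(\<lambda>n. la (Suc (r n))) \<longlonglongrightarrow> l'" "(\<lambda>n. lb (Suc (r n))) \<longlonglongrightarrow> m'"
    using tendsto_fst[OF ps] tendsto_fst[OF p1] tendsto_fst[OF p2] tendsto_snd[OF p2] by simp_all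
  have kkt': "kkt x' y' l' m'" by (rule cluster_point_kkt[OF kkt r lim])
  \<comment> \<open>The cluster point now replaces the given solution as reference. The merit
    relative to it converges along the full sequence and tends to 0 along the subsequence, hence
    tends to 0.\<close>
  obtain V where V: "total_merit x' y' l' m' \<longlonglongrightarrow> V" using total_merit_convergent[OF kkt'] .
  have "(\<lambda>n. total_merit x' y' l' m' (Suc (r n))) \<longlonglongrightarrow> V"
    using LIMSEQ_subseq_LIMSEQ[OF LIMSEQ_Suc[OF V] r] by (simp add: o_def)
  moreover have "(\<lambda>n. total_merit x' y' l' m' (Suc (r n))) \<longlonglongrightarrow> merit \<rho>a x' l' x' l' + merit \<rho>b y' m' y' m'"
    by (intro tendsto_add tendsto_merit tendsto_const \<rho>a \<rho>b lim)
  ultimately have "V = 0" using LIMSEQ_unique by (fastforce simp: merit_def)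
  then have "(\<lambda>k. za k - x') \<longlonglongrightarrow> 0" "(\<lambda>k. zb k - y') \<longlonglongrightarrow> 0"
    using total_merit_tendsto_zero(1,2)[where r = "\<lambda>k. k" and x = "\<lambda>_. x'" and y = "\<lambda>_. y'"
        and l = "\<lambda>_. l'" and m = "\<lambda>_. m'"] V by auto
  then show ?thesis
    using kkt_saddle_point[OF kkt'] by (auto simp: LIM_zero_iff)
qed

end

section \<open>The Lagrangian at feasible and infeasible points\<close>

lemma lagrangian_cost_sum:
  assumes "x \<in> prodA P" and "y \<in> prodB P"
  shows "(\<Sum>i=1..nblocks P. ereal (cost P i (block (blkA P) i x) (block (blkB P) i y))
        + ind (XAi P i) (block (blkA P) i x) - ind (XBi P i) (block (blkB P) i y))
      = ereal (total_cost P x y)"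
proof -
  have "(\<Sum>i=1..nblocks P. ereal (cost P i (block (blkA P) i x) (block (blkB P) i y))
        + ind (XAi P i) (block (blkA P) i x) - ind (XBi P i) (block (blkB P) i y))
      = (\<Sum>i=1..nblocks P. ereal (cost P i (block (blkA P) i x) (block (blkB P) i y)))"
    using assms by (intro sum.cong) (auto simp: ind_def prodA_def prodB_def block_product_def)
  then show ?thesis by (simp add: total_cost_def)
qed

lemma lagrangian_feasible:
  assumes "x \<in> prodA P" and "y \<in> prodB P" and "z \<in> XA P" and "w \<in> XB P"
  shows "lagrangian P x y z w l m = ereal (total_cost P x y + l \<bullet> (x - z) - m \<bullet> (y - w))"
  unfolding lagrangian_def lagrangian_cost_sum[OF assms(1,2)]
  using assms(3,4) by (simp add: ind_def)

lemma aug_lagrangian_feasible: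
  assumes "x \<in> prodA P" and "y \<in> prodB P" and "z \<in> XA P" and "w \<in> XB P"
  shows "aug_lagrangian P \<rho>a \<rho>b x y z w l m = ereal (total_cost P x y + l \<bullet> (x - z) - m \<bullet> (y - w)
    + \<rho>a / 2 * (norm (x - z))\<^sup>2 - \<rho>b / 2 * (norm (y - w))\<^sup>2)"
  by (simp add: aug_lagrangian_def lagrangian_feasible[OF assms])

text \<open>Infinities never cancel to a finite value in \<open>ereal\<close>, so finiteness passes
  to every summand and each indicator can be read off in turn.\<close>

lemma lagrangian_finite_imp_feasible:
  assumes "\<bar>lagrangian P x y z w l m\<bar> \<noteq> \<infinity>"
  shows "x \<in> prodA P" and "y \<in> prodB P" and "z \<in> XA P" and "w \<in> XB P"
proof -
  have add: "\<bar>a + b\<bar> \<noteq> \<infinity> \<Longrightarrow> \<bar>a\<bar> \<noteq> \<infinity> \<and> \<bar>b\<bar> \<noteq> \<infinity>"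
    and sub: "\<bar>a - b\<bar> \<noteq> \<infinity> \<Longrightarrow> \<bar>a\<bar> \<noteq> \<infinity> \<and> \<bar>b\<bar> \<noteq> \<infinity>" for a b :: ereal
    by (cases a; cases b; simp)+
  have ind: "\<bar>ind S s\<bar> \<noteq> \<infinity> \<longleftrightarrow> s \<in> S" for S :: "'c set" and s by (simp add: ind_def)
  let ?t = "\<lambda>i. ereal (cost P i (block (blkA P) i x) (block (blkB P) i y))
        + ind (XAi P i) (block (blkA P) i x) - ind (XBi P i) (block (blkB P) i y)"
  note w = sub[OF assms[unfolded lagrangian_def]]
  note zz = add[OF conjunct1[OF sub[OF conjunct1[OF w]]]]
  show "w \<in> XB P" "z \<in> XA P" using w zz by (simp_all add: ind)
  have "\<bar>\<Sum>i=1..nblocks P. ?t i\<bar> \<noteq> \<infinity>" by (rule conjunct1[OF add[OF conjunct1[OF zz]]])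
  then have t: "\<bar>?t i\<bar> \<noteq> \<infinity>" if "i \<in> {1..nblocks P}" for i
    using that by (auto simp: sum_Inf)
  have "block (blkB P) i y \<in> XBi P i \<and> block (blkA P) i x \<in> XAi P i"
    if i: "i \<in> {1..nblocks P}" for i
    using conjunct2[OF sub[OF t[OF i]]] conjunct2[OF add[OF conjunct1[OF sub[OF t[OF i]]]]]
    unfolding ind by (rule conjI)
  then show "x \<in> prodA P" "y \<in> prodB P"
    by (auto simp: prodA_def prodB_def block_product_def)
qed

text \<open>This and the next lemma force the unconstrained minimization and maximization over the
  copies into \<open>XA P\<close> and \<open>XB P\<close>, since feasible competitors have finite
  values.\<close>

lemma aug_lagrangian_infeasible_XA:
  assumes "x \<in> prodA P" and "y \<in> prodB P" and "z \<notin> XA P" and "w \<in> XB P"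
  shows "aug_lagrangian P \<rho>a \<rho>b x y z w l m = \<infinity>"
  unfolding aug_lagrangian_def lagrangian_def lagrangian_cost_sum[OF assms(1,2)]
  using assms(3,4) by (simp add: ind_def)

lemma aug_lagrangian_infeasible_XB:
  assumes "x \<in> prodA P" and "y \<in> prodB P" and "z \<in> XA P" and "w \<notin> XB P"
  shows "aug_lagrangian P \<rho>a \<rho>b x y z w l m = -\<infinity>"
  unfolding aug_lagrangian_def lagrangian_def lagrangian_cost_sum[OF assms(1,2)]
  using assms(3,4) by (simp add: ind_def)

text \<open>Test with \<open>l + d\<close>. Optimality of the multipliers thereby forces each
  variable to agree with its copy.\<close>

lemma inner_le_all_imp_zero:
  fixes d l :: "'a::real_inner"
  assumes "\<And>l'. l' \<bullet> d \<le> l \<bullet> d"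
  shows "d = 0"
proof -
  have "d \<bullet> d \<le> 0" using assms[of "l + d"] by (simp add: inner_add_left)
  then show ?thesis by (metis inner_gt_zero_iff not_less)
qed

section \<open>Convergence of SP-ADMM for the constrained min-max problem\<close>

theorem proposition2:
  fixes P :: "('na::finite, 'nb::finite) minmax_problem"
    and \<rho>a \<rho>b :: real
    and xa za la :: "nat \<Rightarrow> real^'na"
    and xb zb lb :: "nat \<Rightarrow> real^'nb"
  assumes "nblocks P \<ge> 1"
    and "\<And>j. blkA P j \<in> {1..nblocks P}"
    and "\<And>j. blkB P j \<in> {1..nblocks P}"
    and "\<And>i. i \<in> {1..nblocks P} \<Longrightarrow>
           XAi P i \<subseteq> block_space (blkA P) i \<and> compact (XAi P i) \<and> convex (XAi P i)"
    and "\<And>i. i \<in> {1..nblocks P} \<Longrightarrow>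
           XBi P i \<subseteq> block_space (blkB P) i \<and> compact (XBi P i) \<and> convex (XBi P i)"
    and "compact (XA P)" and "convex (XA P)"
    and "compact (XB P)" and "convex (XB P)"
    and "\<And>i v. i \<in> {1..nblocks P} \<Longrightarrow> v \<in> XBi P i \<Longrightarrow>
           convex_on (XAi P i) (\<lambda>u. cost P i u v) \<and> lsc_on (XAi P i) (\<lambda>u. cost P i u v)"
    and "\<And>i u. i \<in> {1..nblocks P} \<Longrightarrow> u \<in> XAi P i \<Longrightarrow>
           concave_on (XBi P i) (\<lambda>v. cost P i u v) \<and> usc_on (XBi P i) (\<lambda>v. cost P i u v)"
    and "\<exists>xas xbs zas zbs las lbs.
           \<bar>lagrangian P xas xbs zas zbs las lbs\<bar> \<noteq> \<infinity> \<and>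
           (\<forall>l. lagrangian P xas xbs zas zbs l lbs \<le> lagrangian P xas xbs zas zbs las lbs) \<and>
           (\<forall>x z. lagrangian P xas xbs zas zbs las lbs \<le> lagrangian P x xbs z zbs las lbs) \<and>
           (\<forall>x z. lagrangian P xas x zas z las lbs \<le> lagrangian P xas xbs zas zbs las lbs) \<and>
           (\<forall>l. lagrangian P xas xbs zas zbs las lbs \<le> lagrangian P xas xbs zas zbs las l)"
    and "\<rho>a > 0" and "\<rho>b > 0"
    and "sp_admm P \<rho>a \<rho>b xa xb za zb la lb"
  shows "\<exists>xa_bar xb_bar.
           saddle_point_on (XA P \<inter> prodA P) (XB P \<inter> prodB P) (total_cost P) xa_bar xb_bar \<and>
           za \<longlonglongrightarrow> xa_bar \<and> zb \<longlonglongrightarrow> xb_bar"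
proof -
  let ?A = "prodA P" and ?B = "prodB P" and ?F = "total_cost P"
  note XAi = assms(4) and XBi = assms(5)
  have closedA: "closed ?A"
    unfolding prodA_def using XAi by (blast intro: closed_block_product compact_imp_closed)
  have closedB: "closed ?B"
    unfolding prodB_def using XBi by (blast intro: closed_block_product compact_imp_closed)
  have F1: "convex_on ?A (\<lambda>u. ?F u v)" "lsc_on ?A (\<lambda>u. ?F u v)" if v: "v \<in> ?B" for v
  proof -
    have "convex_on (XAi P i) (\<lambda>u. cost P i u (block (blkB P) i v)) \<and>
        lsc_on (XAi P i) (\<lambda>u. cost P i u (block (blkB P) i v))" if "i \<in> {1..nblocks P}" for i
      using assms(10)[OF that] v that by (simp add: prodB_def block_product_def)
    then show "convex_on ?A (\<lambda>u. ?F u v)" "lsc_on ?A (\<lambda>u. ?F u v)"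
      unfolding total_cost_def prodA_def by (intro convex_on_block_sum lsc_on_block_sum; blast)+
  qed
  \<comment> \<open>The maximizer's side is stated for the negated cost, so that the lemmas on
    minimization apply to it.\<close>
  have F2: "convex_on ?B (\<lambda>v. - ?F u v)" "lsc_on ?B (\<lambda>v. - ?F u v)" if u: "u \<in> ?A" for u
  proof -
    have "convex_on (XBi P i) (\<lambda>v. - cost P i (block (blkA P) i u) v) \<and>
        lsc_on (XBi P i) (\<lambda>v. - cost P i (block (blkA P) i u) v)" if "i \<in> {1..nblocks P}" for i
      using assms(11)[OF that] u that
      by (simp add: prodA_def block_product_def concave_on_def usc_on_iff_lsc_on_uminus)
    then show "convex_on ?B (\<lambda>v. - ?F u v)" "lsc_on ?B (\<lambda>v. - ?F u v)"
      unfolding total_cost_def prodB_def sum_negf[symmetric]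
      by (intro convex_on_block_sum lsc_on_block_sum; blast)+
  qed
  note alg = assms(15)[unfolded sp_admm_def]
  have xk: "saddle_point_on ?A ?B (\<lambda>u v. aug_lagrangian P \<rho>a \<rho>b u v (za k) (zb k) (la k) (lb k))
        (xa (Suc k)) (xb (Suc k))"
    and zak: "is_arg_min (\<lambda>u. aug_lagrangian P \<rho>a \<rho>b (xa (Suc k)) (xb (Suc k)) u (zb k) (la k) (lb k))
        (\<lambda>_. True) (za (Suc k))"
    and zbk: "is_arg_max
        (\<lambda>v. aug_lagrangian P \<rho>a \<rho>b (xa (Suc k)) (xb (Suc k)) (za (Suc k)) v (la k) (lb k))
        (\<lambda>_. True) (zb (Suc k))"
    and lak: "la (Suc k) = la k + \<rho>a *\<^sub>R (xa (Suc k) - za (Suc k))"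
    and lbk: "lb (Suc k) = lb k + \<rho>b *\<^sub>R (xb (Suc k) - zb (Suc k))" for k
    using alg by auto
  have zak_le: "aug_lagrangian P \<rho>a \<rho>b (xa (Suc k)) (xb (Suc k)) (za (Suc k)) (zb k) (la k) (lb k)
      \<le> aug_lagrangian P \<rho>a \<rho>b (xa (Suc k)) (xb (Suc k)) u (zb k) (la k) (lb k)" for k u
    using zak[of k] by (auto simp: is_arg_min_def not_less)
  have zbk_le: "aug_lagrangian P \<rho>a \<rho>b (xa (Suc k)) (xb (Suc k)) (za (Suc k)) v (la k) (lb k)
      \<le> aug_lagrangian P \<rho>a \<rho>b (xa (Suc k)) (xb (Suc k)) (za (Suc k)) (zb (Suc k)) (la k) (lb k)" for k v
    using zbk[of k] by (auto simp: is_arg_max_def not_less)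
  have xm: "xa (Suc k) \<in> ?A" "xb (Suc k) \<in> ?B" for k
    using xk[of k] by (auto simp: saddle_point_on_def)
  \<comment> \<open>The previous copy is the feasible competitor. The two claims are proved together
    because the update of \<open>za\<close> is evaluated at the old \<open>zb k\<close>, and that of
    \<open>zb\<close> at the new \<open>za (Suc k)\<close>.\<close>
  have zm: "za k \<in> XA P \<and> zb k \<in> XB P" for k
  proof (induction k)
    case 0
    then show ?case using alg by simp
  next
    case (Suc k)
    have za: "za (Suc k) \<in> XA P"
      using zak_le[of k "za k"] xm[of k] Suc
      by (auto simp: aug_lagrangian_feasible aug_lagrangian_infeasible_XA intro: ccontr)
    moreover have "zb (Suc k) \<in> XB P"
      using zbk_le[of k "zb k"] xm[of k] Suc za
      by (auto simp: aug_lagrangian_feasible aug_lagrangian_infeasible_XB intro: ccontr)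
    ultimately show ?case ..
  qed
  \<comment> \<open>The projection step is a proximal step with zero cost, center
    \<open>xa (Suc k)\<close> and linear term \<open>- la k\<close>; its gradient at the minimizer
    is \<open>- la (Suc k)\<close>.\<close>
  have na: "la (Suc k) \<in> normal_cone (XA P) (za (Suc k))" for k
    unfolding normal_cone_def
  proof (intro CollectI ballI)
    fix w assume w: "w \<in> XA P"
    have "0 \<le> 0 + (- la k + \<rho>a *\<^sub>R (za (Suc k) - xa (Suc k))) \<bullet> (w - za (Suc k))"
    proof (rule proximal_minimizer_variational_inequality[of "XA P" "\<lambda>_. 0"])
      fix v assume v: "v \<in> XA P"
      show "0 + - la k \<bullet> (za (Suc k) - xa (Suc k)) + \<rho>a / 2 * (norm (za (Suc k) - xa (Suc k)))\<^sup>2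
        \<le> 0 + - la k \<bullet> (v - xa (Suc k)) + \<rho>a / 2 * (norm (v - xa (Suc k)))\<^sup>2"
        using zak_le[of k v] xm[of k] zm[of k] zm[of "Suc k"] v
        by (simp add: aug_lagrangian_feasible inner_diff_right norm_minus_commute)
    qed (use w zm assms(7) in \<open>auto simp: convex_on_def\<close>)
    then show "la (Suc k) \<bullet> (w - za (Suc k)) \<le> 0"
      unfolding lak by (simp add: inner_add_left inner_diff_left algebra_simps)
  qed
  have nb: "lb (Suc k) \<in> normal_cone (XB P) (zb (Suc k))" for k
    unfolding normal_cone_def
  proof (intro CollectI ballI)
    fix w assume w: "w \<in> XB P"
    have "0 \<le> 0 + (- lb k + \<rho>b *\<^sub>R (zb (Suc k) - xb (Suc k))) \<bullet> (w - zb (Suc k))"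
    proof (rule proximal_minimizer_variational_inequality[of "XB P" "\<lambda>_. 0"])
      fix v assume v: "v \<in> XB P"
      show "0 + - lb k \<bullet> (zb (Suc k) - xb (Suc k)) + \<rho>b / 2 * (norm (zb (Suc k) - xb (Suc k)))\<^sup>2
        \<le> 0 + - lb k \<bullet> (v - xb (Suc k)) + \<rho>b / 2 * (norm (v - xb (Suc k)))\<^sup>2"
        using zbk_le[of k v] xm[of k] zm[of k] zm[of "Suc k"] v
        by (simp add: aug_lagrangian_feasible inner_diff_right norm_minus_commute)
    qed (use w zm assms(9) in \<open>auto simp: convex_on_def\<close>)
    then show "lb (Suc k) \<bullet> (w - zb (Suc k)) \<le> 0"
      unfolding lbk by (simp add: inner_add_left inner_diff_left algebra_simps)
  qed
  \<comment> \<open>Each half of the saddle point is a proximal minimization. Adding the two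
    first-order conditions cancels \<open>?F (xa (Suc k)) (xb (Suc k))\<close>, and the multiplier
    update rewrites the gradients in terms of the new multipliers.\<close>
  have xs: "?F (xa (Suc k)) v \<le> ?F u (xb (Suc k))
      + (la (Suc k) + \<rho>a *\<^sub>R (za (Suc k) - za k)) \<bullet> (u - xa (Suc k))
      + (lb (Suc k) + \<rho>b *\<^sub>R (zb (Suc k) - zb k)) \<bullet> (v - xb (Suc k))"
    if u: "u \<in> ?A" and v: "v \<in> ?B" for k u v
  proof -
    have "?F (xa (Suc k)) (xb (Suc k)) \<le> ?F u (xb (Suc k))
        + (la k + \<rho>a *\<^sub>R (xa (Suc k) - za k)) \<bullet> (u - xa (Suc k))"
    proof (rule proximal_minimizer_variational_inequality[OF F1(1)[OF xm(2)] xm(1) u])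
      fix w assume w: "w \<in> ?A"
      then have "aug_lagrangian P \<rho>a \<rho>b (xa (Suc k)) (xb (Suc k)) (za k) (zb k) (la k) (lb k)
        \<le> aug_lagrangian P \<rho>a \<rho>b w (xb (Suc k)) (za k) (zb k) (la k) (lb k)"
        using xk[of k] by (auto simp: saddle_point_on_def)
      then show "?F (xa (Suc k)) (xb (Suc k)) + la k \<bullet> (xa (Suc k) - za k)
          + \<rho>a / 2 * (norm (xa (Suc k) - za k))\<^sup>2
        \<le> ?F w (xb (Suc k)) + la k \<bullet> (w - za k) + \<rho>a / 2 * (norm (w - za k))\<^sup>2"
        using xm[of k] zm[of k] w by (simp add: aug_lagrangian_feasible)
    qed
    moreover have "- ?F (xa (Suc k)) (xb (Suc k)) \<le> - ?F (xa (Suc k)) v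
        + (lb k + \<rho>b *\<^sub>R (xb (Suc k) - zb k)) \<bullet> (v - xb (Suc k))"
    proof (rule proximal_minimizer_variational_inequality[OF F2(1)[OF xm(1)] xm(2) v])
      fix w assume w: "w \<in> ?B"
      then have "aug_lagrangian P \<rho>a \<rho>b (xa (Suc k)) w (za k) (zb k) (la k) (lb k)
        \<le> aug_lagrangian P \<rho>a \<rho>b (xa (Suc k)) (xb (Suc k)) (za k) (zb k) (la k) (lb k)"
        using xk[of k] by (auto simp: saddle_point_on_def)
      then show "- ?F (xa (Suc k)) (xb (Suc k)) + lb k \<bullet> (xb (Suc k) - zb k)
          + \<rho>b / 2 * (norm (xb (Suc k) - zb k))\<^sup>2
        \<le> - ?F (xa (Suc k)) w + lb k \<bullet> (w - zb k) + \<rho>b / 2 * (norm (w - zb k))\<^sup>2"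
        using xm[of k] zm[of k] w by (simp add: aug_lagrangian_feasible)
    qed
    moreover have "la k + \<rho>a *\<^sub>R (xa (Suc k) - za k) = la (Suc k) + \<rho>a *\<^sub>R (za (Suc k) - za k)"
      "lb k + \<rho>b *\<^sub>R (xb (Suc k) - zb k) = lb (Suc k) + \<rho>b *\<^sub>R (zb (Suc k) - zb k)"
      unfolding lak lbk by (simp_all add: algebra_simps)
    ultimately show ?thesis by simp
  qed
  \<comment> \<open>The initial multipliers need not be normal to the constraint sets, so the iteration is
    started at index 1.\<close>
  interpret saddle_admm ?A "XA P" ?B "XB P" ?F \<rho>a \<rho>b "\<lambda>k. xa (Suc k)" "\<lambda>k. za (Suc k)"
    "\<lambda>k. la (Suc k)" "\<lambda>k. xb (Suc k)" "\<lambda>k. zb (Suc k)" "\<lambda>k. lb (Suc k)"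
    by unfold_locales
       (fact closedA closedB assms(13,14) lak lbk xm na nb xs F1(2)
        | simp add: zm compact_imp_closed assms(6,8) F2(2) usc_on_iff_lsc_on_uminus)+
  obtain x y z w l m where fin: "\<bar>lagrangian P x y z w l m\<bar> \<noteq> \<infinity>"
    and L1: "\<forall>l'. lagrangian P x y z w l' m \<le> lagrangian P x y z w l m"
    and L2: "\<forall>x' z'. lagrangian P x y z w l m \<le> lagrangian P x' y z' w l m"
    and L3: "\<forall>y' w'. lagrangian P x y' z w' l m \<le> lagrangian P x y z w l m"
    and L4: "\<forall>m'. lagrangian P x y z w l m \<le> lagrangian P x y z w l m'"
    using assms(12) by (elim exE conjE) (rule that)
  note mem = lagrangian_finite_imp_feasible[OF fin]
  have "x - z = 0"
    by (rule inner_le_all_imp_zero[of _ l]) (use L1 mem in \<open>simp add: lagrangian_feasible\<close>)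
  moreover have "y - w = 0"
    by (rule inner_le_all_imp_zero[of _ m]) (use L4 mem in \<open>simp add: lagrangian_feasible\<close>)
  ultimately have eq: "z = x" "w = y" by simp_all
  \<comment> \<open>The primal variable and its copy vary independently: fixing \<open>u = x\<close>
    yields normality of \<open>l\<close>, fixing \<open>z' = x\<close> yields the minimizer's half
    of the variational inequality.\<close>
  have x: "?F x y \<le> ?F u y + l \<bullet> (u - z')" if "u \<in> ?A" "z' \<in> XA P" for u z'
    using L2[rule_format, of u z'] mem that unfolding eq by (simp add: lagrangian_feasible)
  have y: "?F x v - m \<bullet> (v - w') \<le> ?F x y" if "v \<in> ?B" "w' \<in> XB P" for v w'
    using L3[rule_format, of v w'] mem that unfolding eq by (simp add: lagrangian_feasible)
  have "kkt x y l m"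
    unfolding kkt_def normal_cone_def
  proof (intro conjI CollectI ballI)
    show "x \<in> ?A \<inter> XA P" "y \<in> ?B \<inter> XB P" using mem eq by auto
    show "l \<bullet> (z' - x) \<le> 0" if "z' \<in> XA P" for z'
      using x[OF mem(1) that] by (simp add: inner_diff_right)
    show "m \<bullet> (w' - y) \<le> 0" if "w' \<in> XB P" for w'
      using y[OF mem(2) that] by (simp add: inner_diff_right)
    show "?F x v \<le> ?F u y + l \<bullet> (u - x) + m \<bullet> (v - y)" if "u \<in> ?A" "v \<in> ?B" for u v
      using x[OF that(1), of x] y[OF that(2), of y] mem eq by simp
  qed
  \<comment> \<open>The convergence obtained is that of the shifted sequences, which have the same
    limits as the original ones.\<close>
  from converges_to_saddle_point[OF this] show ?thesis
    by (simp add: filterlim_sequentially_Suc)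
qed

end
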